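(* Let $R$ be a commutative ring with $1$ and $\mathcal{A}$ a set of non-commuting symbols. A normalized $R$-valued multiple Dedekind symbol $D_{\mathcal{A}}$ based on $\mathcal{A}$ is shuffled if and only if its associated multiple reciprocity function $F_{\mathcal{A}}(p,q)=D_{\mathcal{A}}(p,q)D_{\mathcal{A}}(-q,p)^{-1}$ is shuffled.
   Context: $\mathcal{A}^*$ is the set of words in $\mathcal{A}$ (including $\emptyset$), $R\langle\langle\mathcal{A}\rangle\rangle$ the ring of non-commutative formal power series $\sum_{w\in\mathcal{A}^*}c_ww$ with unit group $R\langle\langle\mathcal{A}\rangle\rangle^\times$, $U=\{(p,q)\in\mathbb{Z}^2:\gcd(p,q)=1\}$. An $R$-valued multiple Dedekind symbol based on $\mathcal{A}$ is a map $D:U\to R\langle\langle\mathcal{A}\rangle\rangle^\times$ of the form $1+\sum_{w\neq\emptyset}D^w(p,q)w$ with $D(p,-q)=D(-p,q)$ and $D(p,q)=D(p,p+q)$; it is normalized if $D(1,1)=1$. An $R$-valued multiple reciprocity function based on $\mathcal{A}$ is a map $F:U\to R\langle\langle\mathcal{A}\rangle\rangle^\times$ of the form $1+\sum_{w\neq\emptyset}F^w(p,q)w$ with $F(p,-q)=F(-p,q)$, $F(p,q)F(-q,p)=1$, $F(p,p+q)F(p+q,q)=F(p,q)$. Set $D^\emptyset=F^\emptyset=1$. For words $u=a_1\cdots a_r$, $v=a_{r+1}\cdots a_{r+s}$, $Sh(u,v)$ is the multiset of words $a_{\sigma^{-1}(1)}\cdots a_{\sigma^{-1}(r+s)}$,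 one for each permutation $\sigma$ with $\sigma(1)<\dots<\sigma(r)$, $\sigma(r+1)<\dots<\sigma(r+s)$ (sums over it counted with multiplicity). $D$ (resp. $F$) is called shuffled if $D^u(p,q)D^v(p,q)=\sum_{w\in Sh(u,v)}D^w(p,q)$ (resp. the same with $F$) for all $u,v\in\mathcal{A}^*$ and all $(p,q)\in U$. *)

theory Defs
  imports Complex_Main "HOL-Library.Multiset" "HOL-Combinatorics.Permutations"
begin

text \<open>Formal power series in the non-commuting letters of type \<open>'a\<close>, given by their coefficient
  functions on words. The ring \<open>R\<langle>\<langle>\<A>\<rangle>\<rangle>\<close> over an alphabet \<open>\<A>\<close>, a set of letters which may be
  empty, is the subring \<open>ncps_over \<A>\<close> below.\<close>

typedef ('a, 'r) ncps = "UNIV :: ('a list \<Rightarrow> 'r) set"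
  morphisms ncps_coeff Abs_ncps
  by simp

lemma ncps_coeff_Abs [simp]: "ncps_coeff (Abs_ncps f) = f"
  by (simp add: Abs_ncps_inverse)

lemma ncps_eqI: "(\<And>w. ncps_coeff f w = ncps_coeff g w) \<Longrightarrow> f = g"
  by (metis ext ncps_coeff_inject)

lemma ncps_split_sum:
  fixes x :: "'a list \<Rightarrow> 'a list \<Rightarrow> 'a list \<Rightarrow> 'r::comm_monoid_add"
  shows "(\<Sum>j\<le>length w. \<Sum>i\<le>j. x (take i w) (drop i (take j w)) (drop j w)) =
    (\<Sum>i\<le>length w. \<Sum>k\<le>length w - i. x (take i w) (take k (drop i w)) (drop k (drop i w)))"
  unfolding sum.Sigma[OF finite_atMost ballI[OF finite_atMost]]
  by (rule sum.reindex_bij_witness[where i = "\<lambda>(i, k). (i + k, i)" and j = "\<lambda>(j, i). (i, j - i)"])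
     (auto simp: take_drop add.commute)

instantiation ncps :: (type, ring) ring
begin

definition zero_ncps_def: "0 = Abs_ncps (\<lambda>w. 0)"
definition plus_ncps_def: "f + g = Abs_ncps (\<lambda>w. ncps_coeff f w + ncps_coeff g w)"
definition minus_ncps_def: "f - g = Abs_ncps (\<lambda>w. ncps_coeff f w - ncps_coeff g w)"
definition uminus_ncps_def: "- f = Abs_ncps (\<lambda>w. - ncps_coeff f w)"
definition times_ncps_def:
  "f * g = Abs_ncps (\<lambda>w. \<Sum>i\<le>length w. ncps_coeff f (take i w) * ncps_coeff g (drop i w))"

instance
proof
  fix a b c :: "('a, 'b) ncps"
  show "a * b * c = a * (b * c)"
  proof (rule ncps_eqI)
    fix w
    have "ncps_coeff (a * b * c) w = (\<Sum>j\<le>length w. \<Sum>i\<le>j.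
        ncps_coeff a (take i w) * ncps_coeff b (drop i (take j w)) * ncps_coeff c (drop j w))"
      unfolding times_ncps_def ncps_coeff_Abs sum_distrib_right
      by (intro sum.cong) (auto simp: min_def)
    also have "\<dots> = (\<Sum>i\<le>length w. \<Sum>k\<le>length w - i.
        ncps_coeff a (take i w) * ncps_coeff b (take k (drop i w)) * ncps_coeff c (drop k (drop i w)))"
      by (rule ncps_split_sum)
    also have "\<dots> = ncps_coeff (a * (b * c)) w"
      by (simp add: times_ncps_def sum_distrib_left mult.assoc)
    finally show "ncps_coeff (a * b * c) w = ncps_coeff (a * (b * c)) w" .
  qed
qed (simp_all add: zero_ncps_def plus_ncps_def minus_ncps_def uminus_ncps_def times_ncps_def
       ncps_coeff_inverse algebra_simps sum.distrib)

end

instantiation ncps :: (type, "{ring, monoid_mult}") monoid_mult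
begin

definition one_ncps_def: "1 = Abs_ncps (\<lambda>w. if w = [] then 1 else 0)"

instance
proof
  fix a :: "('a, 'b) ncps"
  show "1 * a = a"
  proof (rule ncps_eqI)
    fix w
    have "ncps_coeff (1 * a) w = (\<Sum>i\<le>length w. if i = 0 then ncps_coeff a w else 0)"
      unfolding times_ncps_def one_ncps_def ncps_coeff_Abs
      by (rule sum.cong) auto
    then show "ncps_coeff (1 * a) w = ncps_coeff a w" by simp
  qed
  show "a * 1 = a"
  proof (rule ncps_eqI)
    fix w
    have "ncps_coeff (a * 1) w = (\<Sum>i\<le>length w. if i = length w then ncps_coeff a w else 0)"
      unfolding times_ncps_def one_ncps_def ncps_coeff_Abs
      by (rule sum.cong) auto
    then show "ncps_coeff (a * 1) w = ncps_coeff a w" by simp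
  qed
qed

end

definition ncps_over :: "'a set \<Rightarrow> ('a, 'r::zero) ncps set" where
  "ncps_over A = {f. \<forall>w. w \<notin> lists A \<longrightarrow> ncps_coeff f w = 0}"

definition ncps_units :: "'a set \<Rightarrow> ('a, 'r::{ring, monoid_mult}) ncps set" where
  "ncps_units A = {f \<in> ncps_over A. \<exists>g \<in> ncps_over A. f * g = 1 \<and> g * f = 1}"

definition ncps_inv :: "('a, 'r::{ring, monoid_mult}) ncps \<Rightarrow> ('a, 'r) ncps" where
  "ncps_inv f = (THE g. f * g = 1 \<and> g * f = 1)"

lemma ncps_inv_eqI:
  assumes "f * g = 1" and "g * f = 1"
  shows "ncps_inv f = g"
  unfolding ncps_inv_def
proof (rule the_equality)
  fix h assume "f * h = 1 \<and> h * f = 1"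
  then show "h = g" by (metis assms(1) mult.assoc mult_1_left mult_1_right)
qed (use assms in blast)

lemma ncps_unitsD:
  assumes "f \<in> ncps_units A"
  shows "f \<in> ncps_over A" and "ncps_inv f \<in> ncps_over A"
    and "f * ncps_inv f = 1" and "ncps_inv f * f = 1"
proof -
  from assms obtain g where "f \<in> ncps_over A" "g \<in> ncps_over A" "f * g = 1" "g * f = 1"
    by (auto simp: ncps_units_def)
  with ncps_inv_eqI[of f g]
  show "f \<in> ncps_over A" "ncps_inv f \<in> ncps_over A" "f * ncps_inv f = 1" "ncps_inv f * f = 1"
    by simp_all
qed

lemma ncps_inv_units: "f \<in> ncps_units A \<Longrightarrow> ncps_inv f \<in> ncps_units A"
  using ncps_unitsD[of f A] by (auto simp: ncps_units_def)

lemma ncps_over_mult: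
  assumes "f \<in> ncps_over A" and "g \<in> ncps_over A"
  shows "f * g \<in> ncps_over A"
proof -
  have "ncps_coeff f (take i w) * ncps_coeff g (drop i w) = 0" if "w \<notin> lists A" for i w
  proof -
    have "take i w @ drop i w \<notin> lists A" using that by simp
    then have "take i w \<notin> lists A \<or> drop i w \<notin> lists A"
      unfolding append_in_lists_conv by blast
    then show ?thesis using assms by (auto simp: ncps_over_def)
  qed
  then show ?thesis by (simp add: ncps_over_def times_ncps_def)
qed

lemma ncps_units_mult:
  assumes "f \<in> ncps_units A" and "g \<in> ncps_units A"
  shows "f * g \<in> ncps_units A"
proof -
  note f = ncps_unitsD[OF assms(1)] and g = ncps_unitsD[OF assms(2)]
  have "(f * g) * (ncps_inv g * ncps_inv f) = f * (g * ncps_inv g) * ncps_inv f"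
    by (simp only: mult.assoc)
  moreover have "(ncps_inv g * ncps_inv f) * (f * g) = ncps_inv g * (ncps_inv f * f) * g"
    by (simp only: mult.assoc)
  ultimately show ?thesis
    using f g ncps_over_mult unfolding ncps_units_def by fastforce
qed

definition dedekind_U :: "(int \<times> int) set" where
  "dedekind_U = {(p, q). gcd p q = 1}"

text \<open>The sort \<open>{comm_ring, comm_monoid_mult}\<close> of the coefficients is that of commutative rings
  with \<open>1\<close>; unlike \<open>comm_ring_1\<close> it does not exclude the zero ring.\<close>

definition multiple_dedekind_symbol ::
    "'a set \<Rightarrow> (int \<times> int \<Rightarrow> ('a, 'r::{comm_ring, comm_monoid_mult}) ncps) \<Rightarrow> bool" where
  "multiple_dedekind_symbol A D \<longleftrightarrow> (\<forall>(p, q) \<in> dedekind_U.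
     D (p, q) \<in> ncps_units A \<and> ncps_coeff (D (p, q)) [] = 1 \<and>
     D (p, - q) = D (- p, q) \<and> D (p, q) = D (p, p + q))"

definition normalized_symbol ::
    "(int \<times> int \<Rightarrow> ('a, 'r::{comm_ring, comm_monoid_mult}) ncps) \<Rightarrow> bool" where
  "normalized_symbol D \<longleftrightarrow> D (1, 1) = 1"

definition multiple_reciprocity_function ::
    "'a set \<Rightarrow> (int \<times> int \<Rightarrow> ('a, 'r::{comm_ring, comm_monoid_mult}) ncps) \<Rightarrow> bool" where
  "multiple_reciprocity_function A F \<longleftrightarrow> (\<forall>(p, q) \<in> dedekind_U.
     F (p, q) \<in> ncps_units A \<and> ncps_coeff (F (p, q)) [] = 1 \<and>
     F (p, - q) = F (- p, q) \<and> F (p, q) * F (- q, p) = 1 \<and>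
     F (p, p + q) * F (p + q, q) = F (p, q))"

definition associated_reciprocity ::
    "(int \<times> int \<Rightarrow> ('a, 'r::{comm_ring, comm_monoid_mult}) ncps) \<Rightarrow> int \<times> int \<Rightarrow> ('a, 'r) ncps" where
  "associated_reciprocity D = (\<lambda>(p, q). D (p, q) * ncps_inv (D (- q, p)))"

lemma multiple_reciprocity_function_associated:
  assumes "multiple_dedekind_symbol A D"
  shows "multiple_reciprocity_function A (associated_reciprocity D)"
  unfolding multiple_reciprocity_function_def
proof (clarify, intro conjI)
  fix p q assume U: "(p, q) \<in> dedekind_U"
  have mem: "(a, b) \<in> dedekind_U \<longleftrightarrow> gcd a b = 1" for a b by (simp add: dedekind_U_def)
  have pq: "gcd p q = 1" "gcd q p = 1" using U by (simp_all add: mem gcd.commute)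
  have un: "D (a, b) \<in> ncps_units A" and c1: "ncps_coeff (D (a, b)) [] = 1"
    and neg: "D (a, - b) = D (- a, b)" and tr: "D (a, b) = D (a, a + b)"
    if "gcd a b = 1" for a b
    using assms that unfolding multiple_dedekind_symbol_def mem[symmetric] by blast+
  have D1: "D (p, q) \<in> ncps_units A" and D2: "D (- q, p) \<in> ncps_units A"
    using un pq by simp_all
  note inv1 = ncps_unitsD[OF D1] and inv2 = ncps_unitsD[OF D2]
  have neg2: "D (- a, - b) = D (a, b)" if "gcd a b = 1" for a b
    using neg[of a "- b"] that by simp
  show "associated_reciprocity D (p, q) \<in> ncps_units A"
    using D1 D2 by (simp add: associated_reciprocity_def ncps_units_mult ncps_inv_units)
  have coeff_mult: "ncps_coeff (f * g) [] = ncps_coeff f [] * ncps_coeff g []"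
    for f g :: "('a, 'b) ncps" by (simp add: times_ncps_def)
  have "ncps_coeff (D (- q, p) * ncps_inv (D (- q, p))) [] = 1"
    unfolding inv2(3) by (simp add: one_ncps_def)
  then have "ncps_coeff (ncps_inv (D (- q, p))) [] = 1"
    using c1[of "- q" p] pq by (simp add: coeff_mult)
  then show "ncps_coeff (associated_reciprocity D (p, q)) [] = 1"
    using c1[OF pq(1)] by (simp add: associated_reciprocity_def coeff_mult)
  show "associated_reciprocity D (p, - q) = associated_reciprocity D (- p, q)"
    using neg[of p q] neg2[of q p] neg2[of "- q" p] pq neg[of q p]
    by (simp add: associated_reciprocity_def)
  have "D (p, q) * ncps_inv (D (- q, p)) * (D (- q, p) * ncps_inv (D (p, q))) =
      D (p, q) * (ncps_inv (D (- q, p)) * D (- q, p)) * ncps_inv (D (p, q))"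
    by (simp only: mult.assoc)
  then show "associated_reciprocity D (p, q) * associated_reciprocity D (- q, p) = 1"
    using inv1 inv2 neg2[of p q] pq by (simp add: associated_reciprocity_def)
  have g: "gcd (p + q) q = 1" "gcd (p + q) p = 1" "gcd p (p + q) = 1" "gcd q (p + q) = 1"
    using pq gcd_add1[of p q] gcd_add2[of p q] gcd_add1[of q p] gcd_add2[of q p]
    by (simp_all only: add.commute[of q p] gcd.commute[of "p + q"])
  have e1: "D (- (p + q), p) = D (p + q, q)"
    using neg[of "p + q" p] tr[of "p + q" "- p"] g by simp
  have e2: "D (- q, p + q) = D (- q, p)"
    using tr[of "- q" "p + q"] g by simp
  note i = ncps_unitsD[OF un[OF g(1)]]
  have "D (p, q) * ncps_inv (D (p + q, q)) * (D (p + q, q) * ncps_inv (D (- q, p))) =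
      D (p, q) * (ncps_inv (D (p + q, q)) * D (p + q, q)) * ncps_inv (D (- q, p))"
    by (simp only: mult.assoc)
  then show "associated_reciprocity D (p, p + q) * associated_reciprocity D (p + q, q) =
      associated_reciprocity D (p, q)"
    using i tr[OF pq(1)] e1 e2 by (simp add: associated_reciprocity_def)
qed

text \<open>Positions are counted from \<open>0\<close> instead of \<open>1\<close>.\<close>

definition shuffle_perms :: "nat \<Rightarrow> nat \<Rightarrow> (nat \<Rightarrow> nat) set" where
  "shuffle_perms r s = {\<sigma>. \<sigma> permutes {..<r + s} \<and>
     strict_mono_on {..<r} \<sigma> \<and> strict_mono_on {r..<r + s} \<sigma>}"

definition Sh :: "'a list \<Rightarrow> 'a list \<Rightarrow> 'a list multiset" where
  "Sh u v = image_mset (\<lambda>\<sigma>. map (\<lambda>i. (u @ v) ! (inv \<sigma> i)) [0..<length u + length v])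
     (mset_set (shuffle_perms (length u) (length v)))"

lemma finite_shuffle_perms: "finite (shuffle_perms r s)"
  by (rule finite_subset[OF _ finite_permutations[of "{..<r + s}"]]) (auto simp: shuffle_perms_def)

definition shuffled ::
    "'a set \<Rightarrow> (int \<times> int \<Rightarrow> ('a, 'r::{comm_ring, comm_monoid_mult}) ncps) \<Rightarrow> bool" where
  "shuffled A G \<longleftrightarrow> (\<forall>(p, q) \<in> dedekind_U. \<forall>u \<in> lists A. \<forall>v \<in> lists A.
     ncps_coeff (G (p, q)) u * ncps_coeff (G (p, q)) v =
     (\<Sum>w\<in>#Sh u v. ncps_coeff (G (p, q)) w))"

end

theory Submission
  imports Defs "HOL-Combinatorics.Multiset_Permutations"
begin

text \<open>The coproduct \<open>\<Delta>\<close> dual to the shuffle product is multiplicative, because cutting a word in two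
  is compatible with shuffling. A series \<open>f\<close> with constant term \<open>1\<close> satisfies the shuffle relations
  if and only if it is group-like, \<open>\<Delta> f = f \<otimes> f\<close>. So group-like series are closed under products;
  as series with constant term \<open>1\<close> can be cancelled in the tensor square, they are also closed under
  inverses. Hence \<open>F\<close> is shuffled if \<open>D\<close> is. Conversely, \<open>D(p,q) = F(p,q) D(-q,p)\<close> together with
  \<open>D(p,q) = D(p,q mod p)\<close> and \<open>D(1,1) = 1\<close> expresses \<open>D(p,q)\<close>, by the Euclidean algorithm, as a
  product of values of \<open>F\<close>.\<close>

section \<open>Shuffles of words\<close>

fun shuffle_mset :: "'a list \<Rightarrow> 'a list \<Rightarrow> 'a list multiset" where
  "shuffle_mset [] v = {#v#}"
| "shuffle_mset (a # u) [] = {#a # u#}"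
| "shuffle_mset (a # u) (b # v) =
    image_mset (Cons a) (shuffle_mset u (b # v)) + image_mset (Cons b) (shuffle_mset (a # u) v)"

lemma shuffle_mset_Nil2 [simp]: "shuffle_mset u [] = {#u#}"
  by (cases u) auto

lemma set_mset_shuffle_mset: "set_mset (shuffle_mset u v) = shuffles u v"
  by (induction u v rule: shuffle_mset.induct) auto

lemma shuffle_mset_map:
  "shuffle_mset (map f u) (map f v) = image_mset (map f) (shuffle_mset u v)"
  by (induction u v rule: shuffle_mset.induct) (auto simp: multiset.map_comp comp_def)

lemma shuffle_mset_disjoint:
  assumes "set u \<inter> set v = {}"
  shows "shuffle_mset u v = mset_set (shuffles u v)"
  using assms
proof (induction u v rule: shuffle_mset.induct)
  case (3 a u b v)
  then have "(#) a ` shuffles u (b # v) \<inter> (#) b ` shuffles (a # u) v = {}"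
    by auto
  with 3 show ?case
    by (simp add: mset_set_Union image_mset_mset_set)
qed auto

text \<open>Deconcatenation is a homomorphism for the shuffle product; here it is tested against an arbitrary
  function \<open>x\<close> of the two parts.\<close>

lemma sum_shuffle_mset_splits:
  fixes x :: "'a list \<Rightarrow> 'a list \<Rightarrow> 'r::comm_monoid_add"
  shows "(\<Sum>w\<in>#shuffle_mset u v. \<Sum>i\<le>length w. x (take i w) (drop i w)) =
    (\<Sum>i\<le>length u. \<Sum>j\<le>length v. \<Sum>w1\<in>#shuffle_mset (take i u) (take j v).
       \<Sum>w2\<in>#shuffle_mset (drop i u) (drop j v). x w1 w2)"
proof (induction u v arbitrary: x rule: shuffle_mset.induct)
  case (3 a u b v)
  note IH = "3.IH"(1)[of "\<lambda>w1. x (a # w1)"] "3.IH"(2)[of "\<lambda>w1. x (b # w1)"]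
  have "(\<Sum>w\<in>#shuffle_mset (a # u) (b # v). \<Sum>i\<le>length w. x (take i w) (drop i w)) =
    (\<Sum>w\<in>#shuffle_mset (a # u) (b # v). x [] w) +
    ((\<Sum>w\<in>#shuffle_mset u (b # v). \<Sum>i\<le>length w. x (a # take i w) (drop i w)) +
     (\<Sum>w\<in>#shuffle_mset (a # u) v. \<Sum>i\<le>length w. x (b # take i w) (drop i w)))"
    by (simp add: multiset.map_comp comp_def sum.atMost_Suc_shift sum_mset.distrib ac_simps
      del: sum.atMost_Suc)
  then show ?case
    unfolding IH
    by (simp add: multiset.map_comp comp_def sum.atMost_Suc_shift sum_mset.distrib sum.distrib
      ac_simps del: sum.atMost_Suc)
qed simp_all

section \<open>Shuffle permutations\<close>

lemma bij_betw_map_permutes: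
  assumes "distinct xs"
  shows "bij_betw (\<lambda>\<sigma>. map \<sigma> xs) {\<sigma>. \<sigma> permutes set xs} (permutations_of_set (set xs))"
proof (rule bij_betw_imageI)
  show inj: "inj_on (\<lambda>\<sigma>. map \<sigma> xs) {\<sigma>. \<sigma> permutes set xs}"
  proof (rule inj_onI)
    fix \<sigma> \<tau> assume "\<sigma> \<in> {\<sigma>. \<sigma> permutes set xs}" "\<tau> \<in> {\<sigma>. \<sigma> permutes set xs}"
      and "map \<sigma> xs = map \<tau> xs"
    then have "\<sigma> x = \<tau> x" for x
      by (cases "x \<in> set xs") (auto simp: permutes_not_in)
    then show "\<sigma> = \<tau>" ..
  qed
  show "(\<lambda>\<sigma>. map \<sigma> xs) ` {\<sigma>. \<sigma> permutes set xs} = permutations_of_set (set xs)"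
  proof (rule card_subset_eq)
    show "(\<lambda>\<sigma>. map \<sigma> xs) ` {\<sigma>. \<sigma> permutes set xs} \<subseteq> permutations_of_set (set xs)"
      using assms
      by (auto simp: permutes_image distinct_map permutes_inj_on intro!: permutations_of_setI)
    show "card ((\<lambda>\<sigma>. map \<sigma> xs) ` {\<sigma>. \<sigma> permutes set xs}) =
        card (permutations_of_set (set xs))"
      by (simp add: card_image[OF inj] card_permutations)
  qed simp
qed

lemma bij_betw_inv_permutes: "bij_betw inv {\<sigma>. \<sigma> permutes S} {\<sigma>. \<sigma> permutes S}"
  by (rule bij_betw_byWitness[where f' = inv]) (auto simp: permutes_inv_inv permutes_inv)

lemma sorted_wrt_filter_iff:
  "sorted_wrt R (filter P xs) \<longleftrightarrow> sorted_wrt (\<lambda>x y. P x \<and> P y \<longrightarrow> R x y) xs"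
  by (induction xs) auto

lemma strict_mono_on_iff_reflects_less:
  fixes f :: "'a::linorder \<Rightarrow> 'b::linorder"
  assumes "inj_on f S"
  shows "strict_mono_on S f \<longleftrightarrow> (\<forall>x\<in>S. \<forall>y\<in>S. f x < f y \<longrightarrow> x < y)"
proof
  assume "strict_mono_on S f"
  then show "\<forall>x\<in>S. \<forall>y\<in>S. f x < f y \<longrightarrow> x < y"
    by (simp add: strict_mono_on_less)
next
  assume reflects: "\<forall>x\<in>S. \<forall>y\<in>S. f x < f y \<longrightarrow> x < y"
  show "strict_mono_on S f"
  proof (rule strict_mono_onI)
    fix x y assume "x \<in> S" "y \<in> S" "x < y"
    then have "f x \<noteq> f y"
      using assms by (auto dest: inj_onD)
    moreover have "\<not> f y < f x"
      using \<open>x \<in> S\<close> \<open>y \<in> S\<close> \<open>x < y\<close> reflects by (meson less_asym)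
    ultimately show "f x < f y" by simp
  qed
qed

lemma strict_mono_on_permutes_iff_sorted_wrt:
  assumes "\<sigma> permutes {..<n}"
  shows "strict_mono_on {x \<in> {..<n}. P x} \<sigma> \<longleftrightarrow>
    sorted_wrt (<) (filter P (map (inv \<sigma>) [0..<n]))"
proof -
  have "sorted_wrt (<) (filter P (map (inv \<sigma>) [0..<n])) \<longleftrightarrow>
      (\<forall>i\<in>{..<n}. \<forall>j\<in>{..<n}. i < j \<longrightarrow> P (inv \<sigma> i) \<and> P (inv \<sigma> j) \<longrightarrow> inv \<sigma> i < inv \<sigma> j)"
    unfolding sorted_wrt_filter_iff by (auto simp: sorted_wrt_iff_nth_less)
  also have "\<dots> \<longleftrightarrow> (\<forall>i\<in>\<sigma> ` {..<n}. \<forall>j\<in>\<sigma> ` {..<n}.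
      i < j \<longrightarrow> P (inv \<sigma> i) \<and> P (inv \<sigma> j) \<longrightarrow> inv \<sigma> i < inv \<sigma> j)"
    by (simp only: permutes_image[OF assms])
  also have "\<dots> \<longleftrightarrow> (\<forall>x\<in>{x \<in> {..<n}. P x}. \<forall>y\<in>{x \<in> {..<n}. P x}. \<sigma> x < \<sigma> y \<longrightarrow> x < y)"
    by (auto simp: permutes_inverses[OF assms])
  also have "\<dots> \<longleftrightarrow> strict_mono_on {x \<in> {..<n}. P x} \<sigma>"
    by (rule strict_mono_on_iff_reflects_less[symmetric]) (rule permutes_inj_on[OF assms])
  finally show ?thesis ..
qed

lemma shuffles_strict_sorted:
  fixes xs ys :: "'a::linorder list"
  assumes xs: "sorted_wrt (<) xs" "\<And>x. x \<in> set xs \<Longrightarrow> P x"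
    and ys: "sorted_wrt (<) ys" "\<And>y. y \<in> set ys \<Longrightarrow> \<not> P y"
  shows "shuffles xs ys = {zs \<in> permutations_of_set (set xs \<union> set ys).
    sorted_wrt (<) (filter P zs) \<and> sorted_wrt (<) (filter (\<lambda>x. \<not> P x) zs)}" (is "_ = ?S")
proof (intro equalityI subsetI)
  fix zs assume zs: "zs \<in> shuffles xs ys"
  then have "zs \<in> partition P -` {(xs, ys)}"
    using inv_image_partition[of xs P ys] xs(2) ys(2) by blast
  then have "filter P zs = xs" "filter (\<lambda>x. \<not> P x) zs = ys"
    by (auto simp: comp_def)
  moreover have "distinct zs"
    using xs ys by (intro distinct_disjoint_shuffles[OF _ _ _ zs]) (auto simp: strict_sorted_iff)
  ultimately show "zs \<in> ?S"
    using xs ys set_shuffles[OF zs] by (auto intro: permutations_of_setI)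
next
  fix zs assume zs: "zs \<in> ?S"
  then have "set zs = set xs \<union> set ys"
    by (simp add: permutations_of_setD)
  then have "set (filter P zs) = set xs" "set (filter (\<lambda>x. \<not> P x) zs) = set ys"
    using xs(2) ys(2) by auto
  then have "filter P zs = xs" "filter (\<lambda>x. \<not> P x) zs = ys"
    using zs xs(1) ys(1) by (auto intro: strict_sorted_equal)
  then show "zs \<in> shuffles xs ys"
    using partition_in_shuffles[of zs P] by simp
qed

lemma bij_betw_shuffle_perms_shuffles:
  "bij_betw (\<lambda>\<sigma>. map (inv \<sigma>) [0..<r + s]) (shuffle_perms r s) (shuffles [0..<r] [r..<r + s])"
proof -
  have "bij_betw (\<lambda>\<sigma>. map (inv \<sigma>) [0..<r + s])
      {\<sigma>. \<sigma> permutes {..<r + s}} (permutations_of_set {..<r + s})"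
    using bij_betw_trans[OF bij_betw_inv_permutes bij_betw_map_permutes[of "[0..<r + s]"]]
    by (simp add: comp_def atLeast0LessThan)
  then have "bij_betw (\<lambda>\<sigma>. map (inv \<sigma>) [0..<r + s])
      {\<sigma> \<in> {\<sigma>. \<sigma> permutes {..<r + s}}.
        strict_mono_on {x \<in> {..<r + s}. x < r} \<sigma> \<and> strict_mono_on {x \<in> {..<r + s}. \<not> x < r} \<sigma>}
      {zs \<in> permutations_of_set {..<r + s}.
        sorted_wrt (<) (filter (\<lambda>x. x < r) zs) \<and> sorted_wrt (<) (filter (\<lambda>x. \<not> x < r) zs)}"
    by (rule bij_betw_Collect) (simp only: mem_Collect_eq strict_mono_on_permutes_iff_sorted_wrt)
  moreover have "{x \<in> {..<r + s}. x < r} = {..<r}" "{x \<in> {..<r + s}. \<not> x < r} = {r..<r + s}"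
    "set [0..<r] \<union> set [r..<r + s] = {..<r + s}"
    by auto
  moreover note shuffles_strict_sorted[of "[0..<r]" "\<lambda>x. x < r" "[r..<r + s]"]
  ultimately show ?thesis
    by (simp add: shuffle_perms_def)
qed

lemma Sh_eq_shuffle_mset: "Sh u v = shuffle_mset u v"
proof -
  let ?r = "length u" and ?s = "length v"
  have "Sh u v = image_mset (map ((!) (u @ v)))
      (image_mset (\<lambda>\<sigma>. map (inv \<sigma>) [0..<?r + ?s]) (mset_set (shuffle_perms ?r ?s)))"
    by (simp add: Sh_def multiset.map_comp comp_def)
  also have "\<dots> = image_mset (map ((!) (u @ v))) (mset_set (shuffles [0..<?r] [?r..<?r + ?s]))"
    using bij_betw_shuffle_perms_shuffles[of ?r ?s]
    by (simp add: bij_betw_def image_mset_mset_set)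
  also have "\<dots> = shuffle_mset (map ((!) (u @ v)) [0..<?r]) (map ((!) (u @ v)) [?r..<?r + ?s])"
    by (simp add: shuffle_mset_map shuffle_mset_disjoint)
  also have "map ((!) (u @ v)) [0..<?r] = u"
    by (rule nth_equalityI) (auto simp: nth_append)
  also have "map ((!) (u @ v)) [?r..<?r + ?s] = v"
    by (rule nth_equalityI) (auto simp: nth_append)
  finally show ?thesis .
qed

section \<open>Group-like series\<close>

text \<open>Functions of two words are the coefficients of elements of the completed tensor square of the
  ring of series, with the product \<open>tensor_mult\<close>.\<close>

definition tensor_mult ::
    "('a list \<Rightarrow> 'a list \<Rightarrow> 'r) \<Rightarrow> ('a list \<Rightarrow> 'a list \<Rightarrow> 'r) \<Rightarrow> 'a list \<Rightarrow> 'a list \<Rightarrow> 'r::semiring_0"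
  where "tensor_mult X Y u v =
    (\<Sum>i\<le>length u. \<Sum>j\<le>length v. X (take i u) (take j v) * Y (drop i u) (drop j v))"

definition tensor_square :: "('a, 'r::times) ncps \<Rightarrow> 'a list \<Rightarrow> 'a list \<Rightarrow> 'r" where
  "tensor_square f u v = ncps_coeff f u * ncps_coeff f v"

definition shuffle_coproduct ::
    "('a, 'r::comm_monoid_add) ncps \<Rightarrow> 'a list \<Rightarrow> 'a list \<Rightarrow> 'r" where
  "shuffle_coproduct f u v = (\<Sum>w\<in>#shuffle_mset u v. ncps_coeff f w)"

lemma tensor_mult_cancel_left:
  fixes C X Y :: "'a list \<Rightarrow> 'a list \<Rightarrow> 'r::{ring, monoid_mult}"
  assumes C: "C [] [] = 1" and eq: "tensor_mult C X = tensor_mult C Y"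
  shows "X = Y"
proof -
  let ?I = "\<lambda>u v. {..length u} \<times> {..length v} - {(0, 0)}"
  let ?term = "\<lambda>u v Z (i, j). C (take i u) (take j v) * Z (drop i u) (drop j v)"
  have leading_term: "tensor_mult C Z u v = Z u v + (\<Sum>k\<in>?I u v. ?term u v Z k)" for Z u v
  proof -
    have "tensor_mult C Z u v = (\<Sum>k\<in>{..length u} \<times> {..length v}. ?term u v Z k)"
      by (simp add: tensor_mult_def sum.cartesian_product)
    also have "\<dots> = ?term u v Z (0, 0) + (\<Sum>k\<in>?I u v. ?term u v Z k)"
      by (rule sum.remove) simp_all
    finally show ?thesis
      by (simp add: C)
  qed
  have "X u v = Y u v" for u v
  proof (induction "length u + length v" arbitrary: u v rule: less_induct)
    case less
    have "(\<Sum>k\<in>?I u v. ?term u v X k) = (\<Sum>k\<in>?I u v. ?term u v Y k)"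
    proof (rule sum.cong)
      fix k assume "k \<in> ?I u v"
      moreover obtain i j where "k = (i, j)" by fastforce
      ultimately show "?term u v X k = ?term u v Y k"
        using less[of "drop i u" "drop j v"] by auto
    qed simp
    moreover have "tensor_mult C X u v = tensor_mult C Y u v"
      by (simp only: eq)
    ultimately show ?case
      by (simp only: leading_term add_right_cancel)
  qed
  then show ?thesis by blast
qed

lemma ncps_coeff_mult:
  "ncps_coeff (f * g) w = (\<Sum>i\<le>length w. ncps_coeff f (take i w) * ncps_coeff g (drop i w))"
  by (simp add: times_ncps_def)

lemma tensor_square_mult:
  fixes f g :: "('a, 'r::comm_ring) ncps"
  shows "tensor_square (f * g) = tensor_mult (tensor_square f) (tensor_square g)"
  by (intro ext) (simp add: tensor_square_def tensor_mult_def ncps_coeff_mult sum_product ac_simps)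

lemma shuffle_coproduct_mult:
  "shuffle_coproduct (f * g) = tensor_mult (shuffle_coproduct f) (shuffle_coproduct g)"
proof (intro ext)
  fix u v
  show "shuffle_coproduct (f * g) u v =
      tensor_mult (shuffle_coproduct f) (shuffle_coproduct g) u v"
    unfolding shuffle_coproduct_def tensor_mult_def ncps_coeff_mult
      sum_shuffle_mset_splits[where x = "\<lambda>w1 w2. ncps_coeff f w1 * ncps_coeff g w2"]
    by (simp add: sum_mset_distrib_left[symmetric] sum_mset_distrib_right[symmetric])
qed

definition group_like :: "('a, 'r::{ring, monoid_mult}) ncps \<Rightarrow> bool" where
  "group_like f \<longleftrightarrow> ncps_coeff f [] = 1 \<and> shuffle_coproduct f = tensor_square f"

lemma group_like_one: "group_like 1"
proof -
  have "shuffle_coproduct 1 u v = tensor_square 1 u v" for u v :: "'a list"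
    by (cases u; cases v)
      (simp_all add: shuffle_coproduct_def tensor_square_def one_ncps_def multiset.map_comp comp_def)
  then show ?thesis
    by (auto simp: group_like_def one_ncps_def)
qed

lemma group_like_mult:
  fixes f g :: "('a, 'r::{comm_ring, comm_monoid_mult}) ncps"
  assumes "group_like f" and "group_like g"
  shows "group_like (f * g)"
  using assms
  by (simp add: group_like_def shuffle_coproduct_mult tensor_square_mult ncps_coeff_mult)

lemma group_like_mult_cancel_left:
  fixes f g :: "('a, 'r::{comm_ring, comm_monoid_mult}) ncps"
  assumes f: "group_like f" and fg: "group_like (f * g)"
  shows "group_like g"
proof -
  have "tensor_mult (tensor_square f) (shuffle_coproduct g) =
      tensor_mult (tensor_square f) (tensor_square g)"
    using f fg by (simp add: group_like_def shuffle_coproduct_mult tensor_square_mult)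
  moreover have "tensor_square f [] [] = 1"
    using f by (simp add: group_like_def tensor_square_def)
  ultimately have "shuffle_coproduct g = tensor_square g"
    by (rule tensor_mult_cancel_left[rotated])
  moreover have "ncps_coeff g [] = 1"
    using f fg by (simp add: group_like_def ncps_coeff_mult)
  ultimately show ?thesis by (simp add: group_like_def)
qed

lemma group_like_inv:
  fixes f :: "('a, 'r::{comm_ring, comm_monoid_mult}) ncps"
  assumes "group_like f" and "f \<in> ncps_units A"
  shows "group_like (ncps_inv f)"
  using group_like_mult_cancel_left[OF assms(1)] ncps_unitsD(3)[OF assms(2)] group_like_one
  by metis

lemma shuffle_coproduct_eq_tensor_square_outside:
  fixes f :: "('a, 'r::{ring, monoid_mult}) ncps"
  assumes f: "f \<in> ncps_over A" and uv: "u \<notin> lists A \<or> v \<notin> lists A"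
  shows "shuffle_coproduct f u v = tensor_square f u v"
proof -
  have "ncps_coeff f w = 0" if "w \<in># shuffle_mset u v" for w
  proof -
    have "set w = set u \<union> set v"
      using that by (auto simp: set_mset_shuffle_mset dest: set_shuffles)
    then have "w \<notin> lists A"
      using uv by (auto simp: in_lists_conv_set)
    then show ?thesis
      using f by (simp add: ncps_over_def)
  qed
  then have "shuffle_coproduct f u v = 0"
    by (simp add: shuffle_coproduct_def sum_mset.neutral)
  moreover have "tensor_square f u v = 0"
    using f uv by (auto simp: tensor_square_def ncps_over_def)
  ultimately show ?thesis by simp
qed

lemma group_like_iff_Sh:
  fixes f :: "('a, 'r::{ring, monoid_mult}) ncps"
  assumes f: "f \<in> ncps_over A" and "ncps_coeff f [] = 1"
  shows "group_like f \<longleftrightarrow> (\<forall>u\<in>lists A. \<forall>v\<in>lists A.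
    ncps_coeff f u * ncps_coeff f v = (\<Sum>w\<in>#Sh u v. ncps_coeff f w))"
proof -
  have "group_like f \<longleftrightarrow> (\<forall>u v. shuffle_coproduct f u v = tensor_square f u v)"
    using assms(2) by (auto simp: group_like_def)
  also have "\<dots> \<longleftrightarrow>
      (\<forall>u\<in>lists A. \<forall>v\<in>lists A. shuffle_coproduct f u v = tensor_square f u v)"
    using shuffle_coproduct_eq_tensor_square_outside[OF f] by blast
  finally show ?thesis
    by (simp add: shuffle_coproduct_def tensor_square_def Sh_eq_shuffle_mset eq_commute)
qed

section \<open>Dedekind symbols\<close>

lemma mem_dedekind_U_iff: "(p, q) \<in> dedekind_U \<longleftrightarrow> coprime p q"
  by (simp only: dedekind_U_def mem_Collect_eq prod.case coprime_iff_gcd_eq_1)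

lemma shuffled_iff_group_like:
  assumes "\<And>p q. coprime p q \<Longrightarrow> G (p, q) \<in> ncps_units A \<and> ncps_coeff (G (p, q)) [] = 1"
  shows "shuffled A G \<longleftrightarrow> (\<forall>p q. coprime p q \<longrightarrow> group_like (G (p, q)))"
proof -
  have "group_like (G (p, q)) \<longleftrightarrow> (\<forall>u\<in>lists A. \<forall>v\<in>lists A.
      ncps_coeff (G (p, q)) u * ncps_coeff (G (p, q)) v =
      (\<Sum>w\<in>#Sh u v. ncps_coeff (G (p, q)) w))" if "coprime p q" for p q
    using assms[OF that] by (intro group_like_iff_Sh) (auto dest: ncps_unitsD)
  then show ?thesis
    unfolding shuffled_def by (simp add: Ball_def[of dedekind_U] mem_dedekind_U_iff)
qed

lemma multiple_dedekind_symbolD: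
  assumes "multiple_dedekind_symbol A D" and "coprime p q"
  shows "D (p, q) \<in> ncps_units A" and "ncps_coeff (D (p, q)) [] = 1"
    and "D (p, - q) = D (- p, q)" and "D (p, q) = D (p, p + q)"
  using assms(1)[unfolded multiple_dedekind_symbol_def, rule_format,
      OF mem_dedekind_U_iff[THEN iffD2, OF assms(2)]]
  by (auto simp only: prod.case)

lemma multiple_reciprocity_functionD:
  assumes "multiple_reciprocity_function A F" and "coprime p q"
  shows "F (p, q) \<in> ncps_units A" and "ncps_coeff (F (p, q)) [] = 1"
  using assms(1)[unfolded multiple_reciprocity_function_def, rule_format,
      OF mem_dedekind_U_iff[THEN iffD2, OF assms(2)]]
  by (auto simp only: prod.case)

lemma dedekind_symbol_add_mult:
  assumes D: "multiple_dedekind_symbol A D" and "coprime p q"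
  shows "D (p, k * p + q) = D (p, q)"
proof -
  have add_one: "D (p, (i + 1) * p + q) = D (p, i * p + q)" for i
  proof -
    have "coprime p (i * p + q)"
      using assms(2) by (metis coprime_iff_gcd_eq_1 gcd_add_mult)
    from multiple_dedekind_symbolD(4)[OF D this, symmetric] show ?thesis
      by (simp add: algebra_simps)
  qed
  show ?thesis
  proof (induction k rule: int_induct[where k = 0])
    case (step1 i)
    then show ?case using add_one[of i] by simp
  next
    case (step2 i)
    then show ?case using add_one[of "i - 1"] by simp
  qed simp
qed

lemma dedekind_symbol_mod:
  assumes "multiple_dedekind_symbol A D" and "coprime p q"
  shows "D (p, q mod p) = D (p, q)"
proof -
  have "q mod p = - (q div p) * p + q"
    using div_mult_mod_eq[of q p] by linarith
  then show ?thesis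
    by (simp only: dedekind_symbol_add_mult[OF assms])
qed

lemma normalized_dedekind_symbol_unit:
  assumes D: "multiple_dedekind_symbol A D" and "normalized_symbol D" and p: "\<bar>p\<bar> = 1"
  shows "D (p, q) = 1"
proof -
  have "D (p, q) = D (p, 0)"
    using dedekind_symbol_mod[OF D, of p q] p by (auto simp: abs_if split: if_splits)
  also have "\<dots> = D (1, 0)"
    using multiple_dedekind_symbolD(3)[OF D, of 1 0] p by (auto simp: abs_if split: if_splits)
  also have "\<dots> = D (1, 1)"
    using dedekind_symbol_mod[OF D, of 1 1] by simp
  finally show ?thesis
    using assms(2) by (simp add: normalized_symbol_def)
qed

lemma dedekind_symbol_eq_associated_mult:
  assumes "multiple_dedekind_symbol A D" and "coprime p q"
  shows "D (p, q) = associated_reciprocity D (p, q) * D (- q, p)"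
proof -
  have "ncps_inv (D (- q, p)) * D (- q, p) = 1"
    using assms by (intro ncps_unitsD(4) multiple_dedekind_symbolD) (auto simp: coprime_commute)
  then show ?thesis
    by (simp add: associated_reciprocity_def mult.assoc)
qed

lemma normalized_dedekind_symbol_induct:
  assumes D: "multiple_dedekind_symbol A D" and "normalized_symbol D" and "coprime p q"
    and one: "P 1"
    and mult: "\<And>p q f. coprime p q \<Longrightarrow> P f \<Longrightarrow> P (associated_reciprocity D (p, q) * f)"
  shows "P (D (p, q))"
  using assms(3)
proof (induction "nat \<bar>p\<bar>" arbitrary: p q rule: less_induct)
  case less
  note D_unit = normalized_dedekind_symbol_unit[OF assms(1,2)]
  have reciprocity_step: "P (D (p', q'))" if "coprime p' q'" "P (D (- q', p'))" for p' q'
    unfolding dedekind_symbol_eq_associated_mult[OF D that(1)] by (rule mult[OF that])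
  consider (zero) "p = 0" | (unit) "\<bar>p\<bar> = 1" | (nonunit) "\<bar>p\<bar> > 1" by linarith
  then show ?case
  proof cases
    case zero
    then have "\<bar>- q\<bar> = 1"
      using less.prems by simp
    then show ?thesis
      using one less.prems by (simp add: D_unit reciprocity_step)
  next
    case unit
    then show ?thesis using one by (simp add: D_unit)
  next
    case nonunit
    let ?r = "q mod p"
    have coprime: "coprime p ?r"
      using less.prems nonunit by (simp add: coprime_mod_right_iff)
    have "nat \<bar>- ?r\<bar> < nat \<bar>p\<bar>"
      using nonunit abs_mod_less[of p q] by simp
    then have "P (D (- ?r, p))"
      using coprime by (intro less.hyps) (simp_all add: coprime_commute)
    with coprime have "P (D (p, ?r))"
      by (rule reciprocity_step)
    then show ?thesis
      by (simp add: dedekind_symbol_mod[OF D less.prems])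
  qed
qed

theorem theorem4p10:
  fixes A :: "'a set"
    and D :: "int \<times> int \<Rightarrow> ('a, 'r::{comm_ring, comm_monoid_mult}) ncps"
  assumes "multiple_dedekind_symbol A D"
    and "normalized_symbol D"
  shows "shuffled A D \<longleftrightarrow> shuffled A (associated_reciprocity D)"
proof -
  let ?F = "associated_reciprocity D"
  note D = multiple_dedekind_symbolD[OF assms(1)]
    and F = multiple_reciprocity_functionD[OF multiple_reciprocity_function_associated[OF assms(1)]]
  have D_iff: "shuffled A D \<longleftrightarrow> (\<forall>p q. coprime p q \<longrightarrow> group_like (D (p, q)))"
    by (rule shuffled_iff_group_like) (simp add: D(1,2))
  have F_iff: "shuffled A ?F \<longleftrightarrow> (\<forall>p q. coprime p q \<longrightarrow> group_like (?F (p, q)))"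
    by (rule shuffled_iff_group_like) (simp add: F)
  show ?thesis
  proof
    assume "shuffled A D"
    then show "shuffled A ?F"
      unfolding D_iff F_iff
      by (simp add: associated_reciprocity_def group_like_mult group_like_inv[OF _ D(1)]
        coprime_commute)
  next
    assume "shuffled A ?F"
    then have "group_like (D (p, q))" if "coprime p q" for p q
      using normalized_dedekind_symbol_induct[OF assms that, of group_like]
        group_like_one group_like_mult unfolding F_iff by blast
    then show "shuffled A D"
      by (simp add: D_iff)
  qed
qed

end
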